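(* Let $d\geq 2$ and $n\geq 1$ be integers. If $M\subset [n]^d$ is a basic subset, then $$|M|\leq dn-(d-1).$$ Moreover, this bound cannot be improved: for all integers $d\ge 2$ and $n\ge 1$ there exists a basic subset $M\subset[n]^d$ with $|M| = dn-(d-1)$.
   Context: Notation: $[n]=\{1,\ldots,n\}$. A finite subset $M\subset\mathbb{R}^d$ (in particular, a subset $M\subset[n]^d$) is called basic if for any function $f\colon M\to\mathbb{R}$ there exist functions $f_1,\ldots,f_d\colon\mathbb{R}\to\mathbb{R}$ such that $f(x_1,\ldots,x_d)=f_1(x_1)+\ldots+f_d(x_d)$ for every $(x_1,\ldots,x_d)\in M$. *)

theory Defs
  imports "HOL-Analysis.Finite_Cartesian_Product"
begin

text \<open>
  The space \<open>\<real>\<^sup>d\<close> is rendered as \<^typ>\<open>real ^ 'd\<close>, so \<open>d\<close> is \<open>CARD('d)\<close>.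
  Only the values of \<open>f\<close> on \<open>M\<close> matter, hence a function on \<open>M\<close> is represented
  by a total function.
\<close>

definition basic :: "(real ^ 'd) set \<Rightarrow> bool" where
  "basic M \<longleftrightarrow> finite M \<and>
     (\<forall>f :: real ^ 'd \<Rightarrow> real. \<exists>g :: 'd \<Rightarrow> real \<Rightarrow> real.
        \<forall>x\<in>M. f x = (\<Sum>i\<in>UNIV. g i (x $ i)))"

definition grid :: "nat \<Rightarrow> (real ^ 'd) set" where
  "grid n = {x. \<forall>i. x $ i \<in> real ` {1..n}}"

end

theory Submission
  imports Defs "HOL-Library.Function_Algebras"
begin

text \<open>
  The bound is a dimension count.  If \<open>M\<close> is basic, every function on \<open>M\<close> is a sum of functions of
  one coordinate each.  When each coordinate ranges over a finite set \<open>A\<close>, functions of the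
  \<open>i\<close>-th coordinate are combinations of the \<open>card A\<close> indicators of the slices \<open>x $ i = t\<close>; these
  add up to the constant \<open>1\<close> for every \<open>i\<close>, so the constant \<open>1\<close> together with the slices for
  \<open>t \<noteq> a\<close>, where \<open>a \<in> A\<close> is fixed, still spans all sums.  Hence the space of functions on \<open>M\<close>, of
  dimension \<open>card M\<close>, is spanned by \<open>1 + d * (card A - 1)\<close> functions
  (\<open>card_basic_le\<close>); for \<open>card A = n\<close> this number is \<open>d * n - (d - 1)\<close>.

  Equality is attained by the cross: the points of \<open>A\<^sup>d\<close> with at most one coordinate different
  from \<open>a\<close>.  It has exactly \<open>1 + d * (card A - 1)\<close> points (\<open>card_cross\<close>).  It is basic
  (\<open>basic_cross\<close>), because a function on it is its value at the centre plus its increments along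
  the axes, and at each point of the cross at most one increment is nonzero.
\<close>

section \<open>The dimension bound\<close>

text \<open>
  The dimension count takes place in the space of all real functions; functions on \<open>M\<close> will be
  those that vanish outside \<open>M\<close>.
\<close>

interpretation fun_space: vector_space "\<lambda>(c::real) (f :: 'a \<Rightarrow> real) x. c * f x"
  by unfold_locales (auto simp: fun_eq_iff algebra_simps)

lemma sum_fun_apply: "(\<Sum>i\<in>I. f i) x = (\<Sum>i\<in>I. f i x :: real)"
  by (induction I rule: infinite_finite_induct) auto

text \<open>A linear relation between point masses, evaluated at a point, isolates one coefficient.\<close>

lemma independent_point_masses:
  "fun_space.independent (range (\<lambda>x y. of_bool (y = x) :: real))"
proof (subst fun_space.independent_explicit_module, intro allI impI)
  fix T :: "('a \<Rightarrow> real) set" and u v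
  assume T: "finite T" "T \<subseteq> range (\<lambda>x y. of_bool (y = x))"
    and rel: "(\<Sum>v\<in>T. (\<lambda>x. u v * v x)) = 0" and "v \<in> T"
  then obtain x where x: "v = (\<lambda>y. of_bool (y = x))" by blast
  have "u w * w x = (if w = v then u v else 0)" if w: "w \<in> T" for w
  proof -
    obtain z where z: "w = (\<lambda>y. of_bool (y = z))" using T(2) w by blast
    show ?thesis
    proof (cases "z = x")
      case True
      then show ?thesis using x z by simp
    next
      case False
      then show ?thesis using x z by (auto dest: fun_cong[where x = x])
    qed
  qed
  then have "(\<Sum>w\<in>T. u w * w x) = (\<Sum>w\<in>T. if w = v then u v else 0)"
    by (intro sum.cong refl)
  with T(1) \<open>v \<in> T\<close> have "(\<Sum>w\<in>T. u w * w x) = u v" by simp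
  then show "u v = 0" using fun_cong[OF rel, of x] by (simp add: sum_fun_apply)
qed

lemma card_basic_le:
  fixes M :: "(real ^ 'd::finite) set"
  assumes "basic M" and M: "M \<subseteq> {x. \<forall>i. x $ i \<in> A}" and A: "finite A" "a \<in> A"
  shows "card M \<le> 1 + CARD('d) * (card A - 1)"
proof -
  define mass :: "real ^ 'd \<Rightarrow> real ^ 'd \<Rightarrow> real" where "mass x y = of_bool (y = x)" for x y
  define slice :: "'d \<times> real \<Rightarrow> real ^ 'd \<Rightarrow> real"
    where "slice p y = of_bool (y \<in> M \<and> y $ fst p = snd p)" for p y
  define one :: "real ^ 'd \<Rightarrow> real" where "one y = of_bool (y \<in> M)" for y
  define I where "I = (UNIV :: 'd set) \<times> (A - {a})"
  define B where "B = insert one (slice ` I)"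
  have finI: "finite I" using A by (simp add: I_def)
  have mass_in_span: "mass x \<in> fun_space.span B" if "x \<in> M" for x
  proof -
    from \<open>basic M\<close> obtain g where g: "\<forall>y\<in>M. mass x y = (\<Sum>i\<in>UNIV. g i (y $ i))"
      unfolding basic_def by blast
    have expand: "g i t = g i a + (\<Sum>s\<in>A - {a}. (g i s - g i a) * of_bool (t = s))"
      if t: "t \<in> A" for i t
    proof (cases "t = a")
      case True
      then show ?thesis by auto
    next
      case False
      then have "(\<Sum>s\<in>A - {a}. (g i s - g i a) * of_bool (t = s)) =
          (\<Sum>s\<in>A - {a}. if s = t then g i t - g i a else 0)"
        by (intro sum.cong) auto
      with False t A(1) show ?thesis by simp
    qed
    have "mass x = (\<lambda>y. (\<Sum>i\<in>UNIV. g i a) * one y) +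
        (\<Sum>p\<in>I. (\<lambda>y. (g (fst p) (snd p) - g (fst p) a) * slice p y))" (is "_ = ?r")
    proof
      fix y
      show "mass x y = ?r y"
      proof (cases "y \<in> M")
        case True
        then have "mass x y = (\<Sum>i\<in>UNIV. g i a +
            (\<Sum>s\<in>A - {a}. (g i s - g i a) * of_bool (y $ i = s)))"
          using g M expand by (auto intro!: sum.cong)
        also have "\<dots> = ?r y"
          using True by (simp add: sum.distrib sum_fun_apply I_def one_def slice_def
              sum.cartesian_product split_def)
        finally show ?thesis .
      next
        case False
        then show ?thesis using \<open>x \<in> M\<close> by (auto simp: mass_def one_def slice_def sum_fun_apply)
      qed
    qed
    also have "\<dots> \<in> fun_space.span B"
      by (intro fun_space.span_add fun_space.span_sum fun_space.span_scale fun_space.span_base)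
        (auto simp: B_def)
    finally show ?thesis .
  qed
  have inj: "inj_on mass M"
    by (rule inj_onI) (metis mass_def of_bool_eq(1) of_bool_eq(2) zero_neq_one)
  have "mass ` M \<subseteq> range (\<lambda>x y. of_bool (y = x))"
    by (auto simp: mass_def fun_eq_iff)
  then have "fun_space.independent (mass ` M)"
    using independent_point_masses fun_space.independent_mono by blast
  then have "card (mass ` M) \<le> card B"
    using fun_space.independent_span_bound[of B "mass ` M"] mass_in_span finI
    by (auto simp: B_def)
  also have "\<dots> \<le> 1 + card I"
    using card_insert_le_m1[of "1 + card I" "slice ` I" one] card_image_le[OF finI, of slice]
    by (simp add: B_def)
  also have "card I = CARD('d) * (card A - 1)"
    using A by (simp add: I_def card_cartesian_product)
  finally show ?thesis using inj by (simp add: card_image)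
qed

section \<open>The cross attains the bound\<close>

definition axis_point :: "real \<Rightarrow> 'd \<Rightarrow> real \<Rightarrow> real ^ 'd" where
  "axis_point a i t = (\<chi> k. if k = i then t else a)"

definition cross :: "real \<Rightarrow> real set \<Rightarrow> (real ^ 'd) set" where
  "cross a A = insert (\<chi> k. a) ((\<lambda>(i, t). axis_point a i t) ` (UNIV \<times> (A - {a})))"

lemma cross_subset: "a \<in> A \<Longrightarrow> cross a A \<subseteq> {x. \<forall>i. x $ i \<in> A}"
  by (auto simp: cross_def axis_point_def split: if_splits)

lemma card_cross:
  assumes "finite A" "a \<in> A"
  shows "card (cross a A :: (real ^ 'd::finite) set) = 1 + CARD('d) * (card A - 1)"
proof -
  let ?I = "(UNIV :: 'd set) \<times> (A - {a})" and ?p = "\<lambda>(i, t). axis_point a i t :: real ^ 'd"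
  have "inj_on ?p ?I"
    by (auto simp: inj_on_def axis_point_def vec_eq_iff)
  moreover have "(\<chi> k. a) \<notin> ?p ` ?I"
    by (auto simp: axis_point_def vec_eq_iff) metis
  ultimately show ?thesis
    using assms by (simp add: cross_def card_image card_cartesian_product)
qed

text \<open>
  The increments \<open>f (axis_point a i t) - f c\<close>, where \<open>c\<close> is the centre, vanish for \<open>t = a\<close>, so at a
  point of the \<open>i\<close>-th axis only the \<open>i\<close>-th one survives.  The central value \<open>f c\<close> is shared
  equally among the summands.
\<close>

lemma basic_cross:
  assumes "finite A"
  shows "basic (cross a A :: (real ^ 'd::finite) set)"
  unfolding basic_def
proof (intro conjI allI)
  show "finite (cross a A :: (real ^ 'd) set)" using assms by (simp add: cross_def)
next
  fix f :: "real ^ 'd \<Rightarrow> real"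
  define c :: "real ^ 'd" where "c = (\<chi> k. a)"
  define g where "g i t = f c / CARD('d) + (f (axis_point a i t) - f c)" for i t
  have centre: "axis_point a i a = c" for i
    by (simp add: axis_point_def c_def vec_eq_iff)
  have "f x = (\<Sum>i\<in>UNIV. g i (x $ i))" if "x \<in> cross a A" for x
  proof -
    from that consider "x = c" | j t where "x = axis_point a j t"
      by (auto simp: cross_def c_def)
    then show ?thesis
    proof cases
      case 1
      then have "x $ i = a" for i by (simp add: c_def)
      with 1 show ?thesis by (simp add: g_def centre)
    next
      case 2
      have "f (axis_point a i (x $ i)) - f c = (if i = j then f x - f c else 0)" for i
        using centre by (auto simp: 2 axis_point_def)
      then show ?thesis by (simp add: g_def sum.distrib)
    qed
  qed
  then show "\<exists>g. \<forall>x\<in>cross a A. f x = (\<Sum>i\<in>UNIV. g i (x $ i))" by blast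
qed

section \<open>The maximal size of a basic subset of the grid\<close>

theorem theorem1p1:
  fixes n :: nat
  assumes "CARD('d::finite) \<ge> 2" and "n \<ge> 1"
  shows "(\<forall>M :: (real ^ 'd) set. M \<subseteq> grid n \<and> basic M \<longrightarrow>
            int (card M) \<le> int CARD('d) * int n - (int CARD('d) - 1)) \<and>
         (\<exists>M :: (real ^ 'd) set. M \<subseteq> grid n \<and> basic M \<and>
            int (card M) = int CARD('d) * int n - (int CARD('d) - 1))"
proof -
  define A where "A = real ` {1..n}"
  have A: "finite A" "1 \<in> A" "card A = n"
    using assms(2) by (auto simp: A_def card_image intro: image_eqI[of _ _ 1])
  have grid: "grid n = {x :: real ^ 'd. \<forall>i. x $ i \<in> A}"
    by (simp add: grid_def A_def)
  have count: "int (1 + CARD('d) * (card A - 1)) = int CARD('d) * int n - (int CARD('d) - 1)"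
    using assms(2) by (simp add: A(3) of_nat_diff algebra_simps)
  show ?thesis
  proof (intro conjI allI impI)
    fix M :: "(real ^ 'd) set"
    assume "M \<subseteq> grid n \<and> basic M"
    then have "card M \<le> 1 + CARD('d) * (card A - 1)"
      using card_basic_le A grid by blast
    then show "int (card M) \<le> int CARD('d) * int n - (int CARD('d) - 1)"
      using count by linarith
  next
    have "cross 1 A \<subseteq> (grid n :: (real ^ 'd) set)"
      using cross_subset[OF A(2)] grid by blast
    moreover have "basic (cross 1 A :: (real ^ 'd) set)"
      using A(1) by (rule basic_cross)
    moreover have "int (card (cross 1 A :: (real ^ 'd) set)) =
        int CARD('d) * int n - (int CARD('d) - 1)"
      using card_cross[OF A(1,2), where 'd = 'd] count by simp
    ultimately show "\<exists>M :: (real ^ 'd) set. M \<subseteq> grid n \<and> basic M \<and>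
        int (card M) = int CARD('d) * int n - (int CARD('d) - 1)" by blast
  qed
qed

end
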